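(* Let $n,m\ge 1$. Consider $n$ buyers and $m$ datasets, where buyer $i\in[n]$ has a budget $b_i\in\mathbb{R}_{\ge 0}$ and the linear valuation function $\tau_i(\mathbf{x})=\sum_{j=1}^m\tau_{i,j}x_j$ on $[0,1]^m$, with $\tau_{i,j}\in\mathbb{R}_{\ge 0}$. Then there exists a separable pricing function $\mathbf{p}(\mathbf{x})=\sum_{j=1}^m p_j(x_j)$ with each $p_j$ monotone, continuous, convex and piecewise-linear, such that $\mathbf{p}$ maximizes the total revenue $\sum_{i=1}^n r(\mathbf{p}\mid\tau_i,b_i)$ among all separable MLC pricing functions on $[0,1]^m$, and the total number of kinks of $p_1,\dots,p_m$ (the sum over $j\in[m]$ of the number of points of $(0,1)$ at which $p_j$ is not differentiable) is at most $n$.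
   Context: A function $f:[0,1]^m\to\mathbb{R}$ is monotone if $x_j\le y_j$ for all $j$ implies $f(\mathbf{x})\le f(\mathbf{y})$. It is lower-continuous if $f(\hat{\mathbf{x}})=\sup_{\delta>0}\inf\{f(\mathbf{x}):\mathbf{x}\in[0,1]^m,\ \|\mathbf{x}-\hat{\mathbf{x}}\|_\infty\le\delta\}$ for all $\hat{\mathbf{x}}\in[0,1]^m$ (i.e. lower semicontinuous). MLC means monotone and lower-continuous. A pricing function is a monotone function $\mathbf{p}:[0,1]^m\to\mathbb{R}_{\ge 0}$ with $\mathbf{p}(\mathbf{0})=0$. A function is separable if $f(\mathbf{x})=\sum_{j=1}^m f_j(x_j)$ for some functions $f_j:[0,1]\to\mathbb{R}$. For a pricing function $\mathbf{p}$, valuation $\tau:[0,1]^m\to\mathbb{R}_{\ge 0}$ and budget $b$: $F(\mathbf{p}\mid b)=\{\mathbf{x}\in[0,1]^m:\mathbf{p}(\mathbf{x})\le b\}$; $u^*(\mathbf{p}\mid\tau,b)=\sup_{\mathbf{x}\in F(\mathbf{p}\mid b)}(\tau(\mathbf{x})-\mathbf{p}(\mathbf{x}))$; the demand set is $\mathit{OPT}(\mathbf{p}\mid\tau,b)=\{\mathbf{x}\in F(\mathbf{p}\mid b):\tau(\mathbf{x})-\mathbf{p}(\mathbf{x})=u^*(\mathbf{p}\mid\tau,b)\}$; the revenue is $r(\mathbf{p}\mid\tau,b)=\sup_{\mathbf{x}\in\mathit{OPT}(\mathbf{p}\mid\tau,b)}\mathbf{p}(\mathbf{x})$. *)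

theory Defs
  imports "HOL-Analysis.Analysis"
begin

text \<open>
  Functions on \<open>[0,1]\<^sup>m\<close> are total functions on \<open>real ^ 'm\<close> of which only the values on
  \<open>unit_cube\<close> matter; every notion below refers to those values only.  The dimension
  \<open>m = CARD('m)\<close> is automatically at least 1.
\<close>

definition unit_cube :: "(real ^ 'm) set" where
  "unit_cube = {x. \<forall>j. 0 \<le> x $ j \<and> x $ j \<le> 1}"

text \<open>The order on \<open>real ^ 'm\<close> used by \<^const>\<open>mono_on\<close> is the componentwise one.\<close>

text \<open>
  The infimum over a neighbourhood may be \<open>-\<infinity>\<close> for general \<open>f\<close>, hence the extended reals;
  \<^const>\<open>infnorm\<close> is the maximum norm.
\<close>

definition lower_continuous :: "(real ^ 'm \<Rightarrow> real) \<Rightarrow> bool" where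
  "lower_continuous f \<longleftrightarrow>
     (\<forall>y\<in>unit_cube.
        ereal (f y) =
          (SUP \<delta>\<in>{0<..}. INF x\<in>{x \<in> unit_cube. infnorm (x - y) \<le> \<delta>}. ereal (f x)))"

definition MLC :: "(real ^ 'm \<Rightarrow> real) \<Rightarrow> bool" where
  "MLC f \<longleftrightarrow> mono_on unit_cube f \<and> lower_continuous f"

definition pricing_function :: "(real ^ 'm \<Rightarrow> real) \<Rightarrow> bool" where
  "pricing_function p \<longleftrightarrow>
     mono_on unit_cube p \<and> (\<forall>x\<in>unit_cube. 0 \<le> p x) \<and> p 0 = 0"

definition separable :: "(real ^ 'm \<Rightarrow> real) \<Rightarrow> bool" where
  "separable f \<longleftrightarrow>
     (\<exists>g :: 'm \<Rightarrow> real \<Rightarrow> real. \<forall>x\<in>unit_cube. f x = (\<Sum>j\<in>UNIV. g j (x $ j)))"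

definition separable_MLC_pricing :: "(real ^ 'm \<Rightarrow> real) \<Rightarrow> bool" where
  "separable_MLC_pricing p \<longleftrightarrow> pricing_function p \<and> MLC p \<and> separable p"

definition linear_valuation :: "('m \<Rightarrow> real) \<Rightarrow> real ^ 'm \<Rightarrow> real" where
  "linear_valuation c x = (\<Sum>j\<in>UNIV. c j * x $ j)"

definition affordable :: "(real ^ 'm \<Rightarrow> real) \<Rightarrow> real \<Rightarrow> (real ^ 'm) set" where
  "affordable p b = {x \<in> unit_cube. p x \<le> b}"

text \<open>
  The suprema in \<open>opt_utility\<close> and \<open>revenue\<close> are taken in the reals.  For an MLC pricing
  function \<open>p\<close>, a continuous valuation and a budget \<open>b \<ge> 0\<close> they range over nonempty sets
  bounded above: \<open>affordable p b\<close> is compact and contains \<open>0\<close>, the upper semicontinuous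
  utility attains its maximum on it, and prices of affordable points are at most \<open>b\<close>.
\<close>

definition opt_utility ::
    "(real ^ 'm \<Rightarrow> real) \<Rightarrow> (real ^ 'm \<Rightarrow> real) \<Rightarrow> real \<Rightarrow> real" where
  "opt_utility p v b = (SUP x\<in>affordable p b. v x - p x)"

definition demand_set ::
    "(real ^ 'm \<Rightarrow> real) \<Rightarrow> (real ^ 'm \<Rightarrow> real) \<Rightarrow> real \<Rightarrow> (real ^ 'm) set" where
  "demand_set p v b = {x \<in> affordable p b. v x - p x = opt_utility p v b}"

definition revenue ::
    "(real ^ 'm \<Rightarrow> real) \<Rightarrow> (real ^ 'm \<Rightarrow> real) \<Rightarrow> real \<Rightarrow> real" where
  "revenue p v b = (SUP x\<in>demand_set p v b. p x)"

definition total_revenue ::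
    "nat \<Rightarrow> (nat \<Rightarrow> real ^ 'm \<Rightarrow> real) \<Rightarrow> (nat \<Rightarrow> real) \<Rightarrow> (real ^ 'm \<Rightarrow> real) \<Rightarrow> real" where
  "total_revenue n v b p = (\<Sum>i = 1..n. revenue p (v i) (b i))"

definition piecewise_linear :: "(real \<Rightarrow> real) \<Rightarrow> bool" where
  "piecewise_linear f \<longleftrightarrow>
     (\<exists>(k::nat) t :: nat \<Rightarrow> real.
        t 0 = 0 \<and> t k = 1 \<and> (\<forall>i<k. t i < t (Suc i)) \<and>
        (\<forall>i<k. \<exists>a c. \<forall>x\<in>{t i..t (Suc i)}. f x = a * x + c))"

definition kinks :: "(real \<Rightarrow> real) \<Rightarrow> real set" where
  "kinks f = {t \<in> {0<..<1}. \<not> f differentiable (at t)}"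

end

theory Submission
  imports Defs
begin

text \<open>
  Against a separable price a buyer never demands more of dataset \<open>j\<close> than the greatest unconstrained
  demand \<open>X\<^sub>j(\<tau>\<^sub>i\<^sub>j)\<close>, so the revenue from buyer \<open>i\<close> is at most the minimum of \<open>b\<^sub>i\<close> and
  \<open>\<Sum>\<^sub>j p\<^sub>j(X\<^sub>j(\<tau>\<^sub>i\<^sub>j))\<close>, and for convex prices this bound is attained.  Incentive compatibility then
  reduces everything to the convex prices with slopes in the finite set of the \<open>\<tau>\<^sub>i\<^sub>j\<close>, where the price
  of \<open>j\<close> is described by the lengths \<open>y\<^sub>j\<^sub>t\<close> of its segments of slope \<open>t\<close>, summing to 1.  In these weights
  the unconstrained payments are linear, so a concave function is maximized over a product of
  \<open>m\<close> simplices.  Moving along directions that preserve the \<open>m\<close> normalizations and the \<open>n\<close> payments,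
  one finds an optimum with at most \<open>m + n\<close> positive weights, hence with at most \<open>n\<close> kinks.
\<close>

subsection \<open>Convex prices with prescribed slopes\<close>

text \<open>The weights form a probability distribution on the slopes, so segments of these lengths
  tile the unit interval. Zero weights are allowed: all datasets can then share one set
  \<open>T\<close>.\<close>

locale slope_weights =
  fixes T :: "real set" and w :: "real \<Rightarrow> real"
  assumes finite_slopes: "finite T"
    and slopes_nonempty: "T \<noteq> {}"
    and slopes_nonneg: "\<And>t. t \<in> T \<Longrightarrow> 0 \<le> t"
    and weights_nonneg: "\<And>t. t \<in> T \<Longrightarrow> 0 \<le> w t"
    and weights_sum: "sum w T = 1"
begin

text \<open>The indirect utility of a buyer with slope \<open>s\<close>: the integral of
  \<open>cdf\<close> up to \<open>s\<close>, and for \<open>s\<close> in \<open>T\<close> the best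
  value of \<open>s * x - price x\<close>.\<close>

definition indirect :: "real \<Rightarrow> real" where
  "indirect s = (\<Sum>t\<in>T. w t * max 0 (s - t))"

definition cdf :: "real \<Rightarrow> real" where
  "cdf s = (\<Sum>t\<in>{t \<in> T. t \<le> s}. w t)"

definition cdf_left :: "real \<Rightarrow> real" where
  "cdf_left s = (\<Sum>t\<in>{t \<in> T. t < s}. w t)"

text \<open>The conjugate of \<open>indirect\<close>: a convex function whose segments have length \<open>w t\<close> and slope \<open>t\<close>,
  and whose utility-maximizing point for slope \<open>s\<close> is \<open>cdf s\<close>.\<close>

definition price :: "real \<Rightarrow> real" where
  "price x = Max ((\<lambda>s. s * x - indirect s) ` T)"

lemma price_ge: "s \<in> T \<Longrightarrow> s * x - indirect s \<le> price x"
  unfolding price_def using finite_slopes by (intro Max_ge) auto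

lemma price_attained: "\<exists>s\<in>T. price x = s * x - indirect s"
proof -
  have "price x \<in> (\<lambda>s. s * x - indirect s) ` T"
    unfolding price_def using finite_slopes slopes_nonempty by (intro Max_in) auto
  then show ?thesis by auto
qed

lemma price_leI: "(\<And>s. s \<in> T \<Longrightarrow> s * x - indirect s \<le> y) \<Longrightarrow> price x \<le> y"
  using price_attained[of x] by auto

lemma cdf_alt: "cdf s = (\<Sum>t\<in>T. if t \<le> s then w t else 0)"
  unfolding cdf_def using finite_slopes by (simp add: sum.inter_filter)

lemma cdf_left_alt: "cdf_left s = (\<Sum>t\<in>T. if t < s then w t else 0)"
  unfolding cdf_left_def using finite_slopes by (simp add: sum.inter_filter)

text \<open>\<open>cdf s\<close> and \<open>cdf_left s\<close> are the right and left derivatives of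
  the convex function \<open>indirect\<close>. It suffices to compare summands: the slope of
  \<open>max 0 (s - t)\<close> just right of \<open>s\<close> is 1 exactly if
  \<open>t \<le> s\<close>, just left of \<open>s\<close> exactly if \<open>t < s\<close>.\<close>

lemma cdf_subgradient: "cdf s * (s' - s) \<le> indirect s' - indirect s"
  unfolding cdf_alt indirect_def sum_distrib_right sum_subtractf[symmetric]
proof (intro sum_mono)
  fix t assume "t \<in> T"
  then have w: "0 \<le> w t" by (rule weights_nonneg)
  have "(if t \<le> s then s' - s else 0) \<le> max 0 (s' - t) - max 0 (s - t)" by auto
  from mult_left_mono[OF this w]
  show "(if t \<le> s then w t else 0) * (s' - s) \<le> w t * max 0 (s' - t) - w t * max 0 (s - t)"
    by (auto simp: algebra_simps split: if_splits)
qed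

lemma cdf_left_subgradient: "cdf_left s * (s' - s) \<le> indirect s' - indirect s"
  unfolding cdf_left_alt indirect_def sum_distrib_right sum_subtractf[symmetric]
proof (intro sum_mono)
  fix t assume "t \<in> T"
  then have w: "0 \<le> w t" by (rule weights_nonneg)
  have "(if t < s then s' - s else 0) \<le> max 0 (s' - t) - max 0 (s - t)" by auto
  from mult_left_mono[OF this w]
  show "(if t < s then w t else 0) * (s' - s) \<le> w t * max 0 (s' - t) - w t * max 0 (s - t)"
    by (auto simp: algebra_simps split: if_splits)
qed

lemma cdf_left_le_cdf: "cdf_left s \<le> cdf s"
  unfolding cdf_alt cdf_left_alt by (intro sum_mono) (auto simp: weights_nonneg)

lemma cdf_bounds: "0 \<le> cdf s" "cdf s \<le> 1"
proof -
  show "0 \<le> cdf s" unfolding cdf_def by (intro sum_nonneg) (auto simp: weights_nonneg)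
  have "cdf s \<le> sum w T"
    unfolding cdf_def using finite_slopes by (intro sum_mono2) (auto simp: weights_nonneg)
  then show "cdf s \<le> 1" by (simp add: weights_sum)
qed

lemma cdf_eq_1:
  assumes "\<And>t. t \<in> T \<Longrightarrow> w t \<noteq> 0 \<Longrightarrow> t \<le> s"
  shows "cdf s = 1"
  unfolding weights_sum[symmetric] cdf_def
  using finite_slopes assms by (intro sum.mono_neutral_left) auto

text \<open>The points between \<open>cdf_left s\<close> and \<open>cdf s\<close> form the
  subdifferential of \<open>indirect\<close> at \<open>s\<close>, so there the line of slope
  \<open>s\<close> is the highest: the right derivative rules out larger slopes, the left derivative
  smaller ones.\<close>

lemma price_eq:
  assumes s: "s \<in> T" and x: "cdf_left s \<le> x" "x \<le> cdf s"
  shows "price x = s * x - indirect s"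
proof (rule antisym[OF price_leI price_ge[OF s]])
  fix s' assume "s' \<in> T"
  show "s' * x - indirect s' \<le> s * x - indirect s"
  proof (cases "s \<le> s'")
    case True
    then have "x * (s' - s) \<le> cdf s * (s' - s)" using x by (intro mult_right_mono) auto
    then show ?thesis using cdf_subgradient[of s s'] by (simp add: algebra_simps)
  next
    case False
    then have "x * (s' - s) \<le> cdf_left s * (s' - s)"
      using x by (intro mult_right_mono_neg) auto
    then show ?thesis using cdf_left_subgradient[of s s'] by (simp add: algebra_simps)
  qed
qed

text \<open>Conjugacy yields the cost of all segments of slope at most \<open>s\<close>, since
  \<open>s * w t - w t * (s - t) = t * w t\<close>. This makes payments linear in the
  weights.\<close>

lemma price_at_cdf:
  assumes "s \<in> T"
  shows "price (cdf s) = (\<Sum>t\<in>{t \<in> T. t \<le> s}. t * w t)"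
proof -
  have "price (cdf s) = s * cdf s - indirect s"
    by (intro price_eq assms cdf_left_le_cdf order_refl)
  also have "\<dots> = (\<Sum>t\<in>T. if t \<le> s then t * w t else 0)"
    unfolding cdf_alt indirect_def sum_distrib_left sum_subtractf[symmetric]
    by (intro sum.cong) (auto simp: algebra_simps)
  finally show ?thesis using finite_slopes by (simp add: sum.inter_filter)
qed

text \<open>Fenchel's inequality, with equality at \<open>cdf s\<close>.\<close>

lemma cdf_maximizes_utility:
  assumes "s \<in> T"
  shows "s * x - price x \<le> s * cdf s - price (cdf s)"
proof -
  have "price (cdf s) = s * cdf s - indirect s"
    by (intro price_eq assms cdf_left_le_cdf order_refl)
  then show ?thesis using price_ge[OF assms, of x] by simp
qed

section \<open>Affine pieces and kinks\<close>

text \<open>The mass strictly below \<open>s\<close> is the mass up to the next smaller slope. Thus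
  every segment starts at 0 or at a value of \<open>cdf\<close>.\<close>

lemma cdf_left_cases: "cdf_left s = 0 \<or> (\<exists>t\<in>T. t < s \<and> cdf_left s = cdf t)"
proof (cases "{t \<in> T. t < s} = {}")
  case True
  then show ?thesis unfolding cdf_left_def by (metis sum.empty)
next
  case False
  define r where "r = Max {t \<in> T. t < s}"
  have fin: "finite {t \<in> T. t < s}" using finite_slopes by auto
  have r: "r \<in> {t \<in> T. t < s}" unfolding r_def using fin False by (rule Max_in)
  have "\<And>t. t \<in> {t \<in> T. t < s} \<Longrightarrow> t \<le> r" unfolding r_def using fin by (rule Max_ge)
  then have "{t \<in> T. t < s} = {t \<in> T. t \<le> r}" using r by auto
  then show ?thesis using r unfolding cdf_left_def cdf_def by auto
qed

text \<open>The least slope whose cumulative weight exceeds \<open>x\<close> works; the greatest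
  slope is a candidate because its cumulative weight is 1.\<close>

lemma slope_at:
  assumes "0 \<le> x" "x < 1"
  obtains s where "s \<in> T" "cdf_left s \<le> x" "x < cdf s"
proof -
  define A where "A = {s \<in> T. x < cdf s}"
  have fin: "finite A" unfolding A_def using finite_slopes by auto
  have "cdf (Max T) = 1" by (intro cdf_eq_1 Max_ge finite_slopes)
  then have "Max T \<in> A" unfolding A_def using assms Max_in[OF finite_slopes slopes_nonempty] by auto
  then have s: "Min A \<in> A" using fin by (intro Min_in) auto
  have "cdf_left (Min A) \<le> x"
    using cdf_left_cases[of "Min A"]
  proof (elim disjE bexE conjE)
    fix t assume t: "t \<in> T" "t < Min A" "cdf_left (Min A) = cdf t"
    then have "t \<notin> A" using Min_le[OF fin, of t] by auto
    then show ?thesis using t unfolding A_def by auto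
  qed (use assms in simp)
  then show thesis using s that unfolding A_def by auto
qed

text \<open>The segment containing an interior point of the gap has both ends outside the open gap,
  hence covers it.\<close>

lemma price_affine_between:
  assumes "0 \<le> a" "a < c" "c \<le> 1" "{a<..<c} \<inter> cdf ` T = {}"
  shows "\<exists>s\<in>T. \<forall>x\<in>{a..c}. price x = s * x - indirect s"
proof -
  obtain x where mid: "a < x" "x < c" using dense assms by blast
  obtain s where s: "s \<in> T" "cdf_left s \<le> x" "x < cdf s"
    using slope_at[of x] mid assms by auto
  have "cdf_left s \<le> a"
    using cdf_left_cases[of s]
  proof (elim disjE bexE conjE)
    fix t assume "t \<in> T" "cdf_left s = cdf t"
    then have "cdf_left s \<notin> {a<..<c}" using assms(4) by auto
    then show ?thesis using s mid by auto
  qed (use assms in simp)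
  moreover have "cdf s \<notin> {a<..<c}" using assms(4) s by blast
  then have "c \<le> cdf s" using s mid by auto
  ultimately show ?thesis using s(1) by (intro bexI[of _ s] ballI price_eq) auto
qed

lemma kinks_price_subset: "kinks price \<subseteq> cdf ` T \<inter> {0<..<1}"
proof
  fix x assume x: "x \<in> kinks price"
  then have x01: "0 < x" "x < 1" and nd: "\<not> price differentiable (at x)"
    unfolding kinks_def by auto
  have "x \<in> cdf ` T"
  proof (rule ccontr)
    assume nx: "x \<notin> cdf ` T"
    obtain s where s: "s \<in> T" "cdf_left s \<le> x" "x < cdf s" using slope_at[of x] x01 by auto
    have "cdf_left s \<noteq> x" using cdf_left_cases[of s] nx x01 by auto
    then have xin: "x \<in> {cdf_left s<..<cdf s}" using s by auto
    have "((\<lambda>x. s * x - indirect s) has_real_derivative s) (at x)"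
      by (auto intro!: derivative_eq_intros)
    then have "(price has_real_derivative s) (at x)"
      by (rule has_field_derivative_transform_within_open[OF _ open_greaterThanLessThan xin])
        (use s price_eq in auto)
    with nd show False using real_differentiable_def by blast
  qed
  with x01 show "x \<in> cdf ` T \<inter> {0<..<1}" by auto
qed

text \<open>Kinks lie at cumulative weights, and slopes of weight 0 contribute no new ones. The
  largest slope of nonzero weight ends at 1, outside the open unit interval, which makes the bound
  strict.\<close>

lemma card_kinks_price:
  "finite (kinks price)" "card (kinks price) < card {t \<in> T. w t \<noteq> 0}"
proof -
  define S where "S = {t \<in> T. w t \<noteq> 0}"
  have finS: "finite S" unfolding S_def using finite_slopes by auto
  have neS: "S \<noteq> {}"
  proof
    assume "S = {}"
    then have "sum w T = 0" unfolding S_def by (intro sum.neutral) auto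
    then show False using weights_sum by simp
  qed
  have "kinks price \<subseteq> cdf ` (S - {Max S})"
  proof
    fix x assume "x \<in> kinks price"
    then have "x \<in> cdf ` T \<inter> {0<..<1}" using kinks_price_subset by blast
    then obtain t where t: "t \<in> T" "x = cdf t" "0 < cdf t" "cdf t < 1" by auto
    \<comment> \<open>The largest slope up to \<open>t\<close> with nonzero weight has the same
      cumulative weight as \<open>t\<close> and can represent it.\<close>
    define R where "R = {s \<in> S. s \<le> t}"
    have finR: "finite R" unfolding R_def using finS by auto
    have "R \<noteq> {}"
    proof
      assume "R = {}"
      then have "cdf t = 0" unfolding R_def S_def cdf_def by (intro sum.neutral) auto
      then show False using t by simp
    qed
    then have r: "Max R \<in> R" using finR by (intro Max_in)
    have "cdf (Max R) = cdf t"
      unfolding cdf_def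
    proof (intro sum.mono_neutral_left ballI)
      show "{s \<in> T. s \<le> Max R} \<subseteq> {s \<in> T. s \<le> t}" using r unfolding R_def by auto
      fix s assume s: "s \<in> {s \<in> T. s \<le> t} - {s \<in> T. s \<le> Max R}"
      then have "s \<notin> R" using Max_ge[OF finR, of s] by auto
      then show "w s = 0" using s unfolding R_def S_def by auto
    qed (use finite_slopes in auto)
    moreover have "cdf (Max S) = 1"
      by (intro cdf_eq_1 Max_ge finS) (auto simp: S_def)
    ultimately have "Max R \<noteq> Max S" using t by auto
    moreover have "Max R \<in> S" using r unfolding R_def by blast
    ultimately show "x \<in> cdf ` (S - {Max S})"
      using t \<open>cdf (Max R) = cdf t\<close> by (intro image_eqI[of _ _ "Max R"]) auto
  qed
  then have sub: "kinks price \<subseteq> cdf ` (S - {Max S})" .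
  have fin: "finite (S - {Max S})" using finS by simp
  show "finite (kinks price)" using sub fin by (meson finite_imageI finite_subset)
  have "card (kinks price) \<le> card (cdf ` (S - {Max S}))"
    using sub fin by (intro card_mono) auto
  also have "\<dots> \<le> card (S - {Max S})" using fin by (rule card_image_le)
  also have "\<dots> < card S" using finS neS by (intro card_Diff1_less Max_in)
  finally show "card (kinks price) < card {t \<in> T. w t \<noteq> 0}" unfolding S_def .
qed

section \<open>Monotonicity, normalization, convexity and continuity\<close>

lemma price_mono: "mono price"
proof
  fix x y :: real assume "x \<le> y"
  show "price x \<le> price y"
  proof (intro price_leI)
    fix s assume s: "s \<in> T"
    then have "s * x \<le> s * y" using \<open>x \<le> y\<close> slopes_nonneg by (intro mult_left_mono) auto
    then show "s * x - indirect s \<le> price y" using price_ge[OF s, of y] by linarith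
  qed
qed

lemma price_0: "price 0 = 0"
proof -
  have "price 0 \<le> 0"
  proof (intro price_leI)
    fix s
    have "0 \<le> indirect s"
      unfolding indirect_def using weights_nonneg by (intro sum_nonneg mult_nonneg_nonneg) auto
    then show "s * 0 - indirect s \<le> 0" by simp
  qed
  \<comment> \<open>The smallest slope leaves no surplus, so its line passes through the
    origin.\<close>
  moreover have "indirect (Min T) = 0"
    unfolding indirect_def
  proof (intro sum.neutral ballI)
    fix t assume "t \<in> T"
    then have "Min T \<le> t" using finite_slopes by auto
    then show "w t * max 0 (Min T - t) = 0" by simp
  qed
  then have "0 \<le> price 0"
    using price_ge[OF Min_in[OF finite_slopes slopes_nonempty], of 0] by simp
  ultimately show ?thesis by simp
qed

lemma price_convex: "convex_on UNIV price"
proof (intro convex_onI)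
  fix u x y :: real assume l: "0 < u" "u < 1"
  show "price ((1 - u) *\<^sub>R x + u *\<^sub>R y) \<le> (1 - u) * price x + u * price y"
  proof (intro price_leI)
    fix s assume "s \<in> T"
    then have "(1 - u) * (s * x - indirect s) + u * (s * y - indirect s)
        \<le> (1 - u) * price x + u * price y"
      using l by (intro add_mono mult_left_mono price_ge) auto
    then show "s * ((1 - u) *\<^sub>R x + u *\<^sub>R y) - indirect s
        \<le> (1 - u) * price x + u * price y"
      by (simp add: algebra_simps)
  qed
qed auto

lemma price_continuous: "continuous_on UNIV price"
  by (intro convex_on_continuous price_convex open_UNIV)

end

text \<open>Listing \<open>B\<close> in increasing order gives the partition, because no element of
  \<open>B\<close> lies between two neighbours. Taking a set of breakpoints absorbs coinciding
  cumulative weights.\<close>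

lemma piecewise_linearI:
  fixes f :: "real \<Rightarrow> real"
  assumes "finite B" "B \<subseteq> {0..1}" "0 \<in> B" "1 \<in> B"
    and affine: "\<And>u v. \<lbrakk>0 \<le> u; u < v; v \<le> 1; {u<..<v} \<inter> B = {}\<rbrakk> \<Longrightarrow>
      \<exists>a c. \<forall>x\<in>{u..v}. f x = a * x + c"
  shows "piecewise_linear f"
proof -
  define xs where "xs = sorted_list_of_set B"
  have xs: "set xs = B"
    using assms(1) by (auto simp: xs_def)
  have ne: "xs \<noteq> []" using xs assms by auto
  \<comment> \<open>\<open>k\<close> is the number of intervals, one less than the number of
    breakpoints.\<close>
  define k where "k = length xs - 1"
  have k: "length xs = Suc k" using ne by (cases xs) (auto simp: k_def)
  have step: "xs ! i < xs ! j" if "i < j" "j \<le> k" for i j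
    using that k unfolding xs_def by (intro sorted_wrt_nth_less[OF strict_sorted_list_of_set]) auto
  have less: "xs ! i < xs ! j \<longleftrightarrow> i < j" if "i \<le> k" "j \<le> k" for i j
    using step[of i j] step[of j i] that by (cases i j rule: linorder_cases) auto
  have in_B: "xs ! i \<in> B" if "i \<le> k" for i
    using that nth_mem[of i xs] xs k by simp
  have ex: "\<exists>i\<le>k. xs ! i = x" if "x \<in> B" for x
    using that xs k by (auto simp: in_set_conv_nth less_Suc_eq_le)
  have "xs ! 0 = 0"
  proof -
    obtain i where "i \<le> k" "xs ! i = 0" using ex assms by blast
    moreover have "0 \<le> xs ! 0" using in_B[of 0] assms by auto
    ultimately show ?thesis using less[of 0 i] by (cases i) auto
  qed
  moreover have "xs ! k = 1"
  proof -
    obtain i where "i \<le> k" "xs ! i = 1" using ex assms by blast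
    moreover have "xs ! k \<le> 1" using in_B[of k] assms by auto
    ultimately show ?thesis using less[of i k] by (cases "i = k") auto
  qed
  moreover have "\<forall>i<k. \<exists>a c. \<forall>x\<in>{xs ! i..xs ! Suc i}. f x = a * x + c"
  proof (intro allI impI affine)
    fix i assume i: "i < k"
    show "0 \<le> xs ! i" "xs ! Suc i \<le> 1" using in_B[of i] in_B[of "Suc i"] i assms by auto
    show "xs ! i < xs ! Suc i" using less i by simp
    show "{xs ! i<..<xs ! Suc i} \<inter> B = {}"
    proof (rule ccontr)
      assume "\<not> ?thesis"
      then obtain x where x: "x \<in> B" "xs ! i < x" "x < xs ! Suc i" by auto
      then obtain j where "j \<le> k" "xs ! j = x" using ex by blast
      then have "i < j" "j < Suc i" using x less[of i j] less[of j "Suc i"] i by auto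
      then show False by simp
    qed
  qed
  ultimately show ?thesis
    unfolding piecewise_linear_def using less
    by (intro exI[of _ k] exI[of _ "\<lambda>i. xs ! i"]) auto
qed

lemma (in slope_weights) price_piecewise_linear: "piecewise_linear price"
proof (rule piecewise_linearI[of "insert 0 (insert 1 (cdf ` T))"])
  fix u v :: real
  assume uv: "0 \<le> u" "u < v" "v \<le> 1" "{u<..<v} \<inter> insert 0 (insert 1 (cdf ` T)) = {}"
  then have "{u<..<v} \<inter> cdf ` T = {}" by blast
  from price_affine_between[OF uv(1-3) this]
  obtain s where s: "\<forall>x\<in>{u..v}. price x = s * x - indirect s" by blast
  show "\<exists>a c. \<forall>x\<in>{u..v}. price x = a * x + c"
    by (rule exI[of _ s], rule exI[of _ "- indirect s"]) (use s in simp)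
qed (use finite_slopes cdf_bounds in auto)

subsection \<open>Demand and revenue\<close>

text \<open>Without a maximizer, the open sets \<open>W z\<close>, on which \<open>f\<close> stays
  below \<open>f z\<close>, cover \<open>S\<close>. In a finite subcover, the index with the largest
  value would lie in one of these sets and so have a smaller value than another index.\<close>

lemma compact_attains_max_upper_semicontinuous:
  fixes f :: "'a::topological_space \<Rightarrow> real"
  assumes "compact S" "S \<noteq> {}"
    and usc: "\<And>y c. y \<in> S \<Longrightarrow> f y < c \<Longrightarrow> \<exists>U. open U \<and> y \<in> U \<and> (\<forall>x\<in>S \<inter> U. f x < c)"
  obtains x where "x \<in> S" "\<And>y. y \<in> S \<Longrightarrow> f y \<le> f x"
proof (rule ccontr)
  assume *: "\<not> thesis"
  define W where "W z = \<Union>{U. open U \<and> (\<forall>x\<in>S \<inter> U. f x < f z)}" for z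
  have W: "open (W z)" "x \<in> S \<Longrightarrow> x \<in> W z \<Longrightarrow> f x < f z" for z x
    unfolding W_def by auto
  have "S \<subseteq> (\<Union>z\<in>S. W z)"
  proof
    fix y assume y: "y \<in> S"
    have "\<not> (\<forall>z\<in>S. f z \<le> f y)" using * that[of y] y by blast
    then obtain z where z: "z \<in> S" "f y < f z" by (meson not_le)
    then obtain U where "open U" "y \<in> U" "\<forall>x\<in>S \<inter> U. f x < f z" using usc[OF y z(2)] by blast
    then show "y \<in> (\<Union>z\<in>S. W z)" using z unfolding W_def by blast
  qed
  with \<open>compact S\<close> obtain C where C: "C \<subseteq> S" "finite C" "S \<subseteq> (\<Union>z\<in>C. W z)"
    using W(1) by (elim compactE_image)
  have "C \<noteq> {}" using C \<open>S \<noteq> {}\<close> by auto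
  then have "Max (f ` C) \<in> f ` C" using C by (intro Max_in) auto
  then obtain z where z: "z \<in> C" "f z = Max (f ` C)" by auto
  then obtain z' where z': "z' \<in> C" "z \<in> W z'" using C by blast
  then have "f z < f z'" using W(2) z C by blast
  moreover have "f z' \<le> Max (f ` C)" using z' C by (intro Max_ge) auto
  ultimately show False using z by simp
qed

lemma unit_cube_eq_cbox: "unit_cube = cbox 0 (1 :: real ^ 'm)"
  by (auto simp: unit_cube_def mem_box_cart)

lemma compact_unit_cube: "compact (unit_cube :: (real ^ 'm) set)"
  by (simp add: unit_cube_eq_cbox compact_cbox)

lemma convex_unit_cube: "convex (unit_cube :: (real ^ 'm) set)"
  by (simp add: unit_cube_eq_cbox convex_box)

lemma zero_in_unit_cube: "0 \<in> (unit_cube :: (real ^ 'm) set)"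
  by (simp add: unit_cube_def)

text \<open>Turns the sup-inf definition into its epsilon-delta form; Euclidean balls suffice
  because the maximum norm is at most the Euclidean norm.\<close>

lemma lower_continuousD:
  fixes f :: "real ^ 'm \<Rightarrow> real"
  assumes "lower_continuous f" "y \<in> unit_cube" "c < f y"
  obtains \<delta> where "0 < \<delta>" "\<And>x. x \<in> unit_cube \<Longrightarrow> dist x y < \<delta> \<Longrightarrow> c < f x"
proof -
  have eq: "ereal (f y) = (SUP \<delta>\<in>{0<..}. INF x\<in>{x \<in> unit_cube. infnorm (x - y) \<le> \<delta>}. ereal (f x))"
    using assms(1,2) unfolding lower_continuous_def by blast
  have "ereal c < (SUP \<delta>\<in>{0<..}. INF x\<in>{x \<in> unit_cube. infnorm (x - y) \<le> \<delta>}. ereal (f x))"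
    unfolding eq[symmetric] using assms(3) by simp
  then obtain \<delta> :: real where d: "0 < \<delta>"
      "ereal c < (INF x\<in>{x \<in> unit_cube. infnorm (x - y) \<le> \<delta>}. ereal (f x))"
    unfolding less_SUP_iff by auto
  show thesis
  proof (rule that[OF d(1)])
    fix x assume x: "x \<in> unit_cube" "dist x y < \<delta>"
    have "infnorm (x - y) \<le> \<delta>" using infnorm_le_norm[of "x - y"] x by (simp add: dist_norm)
    then have "ereal c < ereal (f x)" using x by (intro less_INF_D[OF d(2)]) auto
    then show "c < f x" by simp
  qed
qed

lemma continuous_on_imp_lower_continuous:
  fixes f :: "real ^ 'm \<Rightarrow> real"
  assumes cont: "continuous_on unit_cube f"
  shows "lower_continuous f"
  unfolding lower_continuous_def
proof (intro ballI antisym)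
  fix y :: "real ^ 'm" assume y: "y \<in> unit_cube"
  let ?I = "\<lambda>\<delta>. INF x\<in>{x \<in> unit_cube. infnorm (x - y) \<le> \<delta>}. ereal (f x)"
  show "(SUP \<delta>\<in>{0<..}. ?I \<delta>) \<le> ereal (f y)"
    using y by (intro SUP_least INF_lower) (auto simp: infnorm_0)
  show "ereal (f y) \<le> (SUP \<delta>\<in>{0<..}. ?I \<delta>)"
  proof (rule ereal_le_epsilon2)
    fix e :: real assume e: "0 < e"
    obtain d where d: "0 < d" "\<And>x. x \<in> unit_cube \<Longrightarrow> dist x y < d \<Longrightarrow> dist (f x) (f y) < e"
      using cont y e unfolding continuous_on_iff by metis
    \<comment> \<open>\<open>K\<close> bounds the Euclidean norm by the maximum norm. The radius
      \<open>d / (2 * K)\<close> then keeps the Euclidean distance at most \<open>d / 2\<close>,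
      strictly below \<open>d\<close>.\<close>
    define K where "K = sqrt DIM(real ^ 'm)"
    have K: "0 < K" unfolding K_def by (metis DIM_positive of_nat_0_less_iff real_sqrt_gt_0_iff)
    have "ereal (f y - e) \<le> ?I (d / (2 * K))"
    proof (intro INF_greatest)
      fix x assume x: "x \<in> {x \<in> unit_cube. infnorm (x - y) \<le> d / (2 * K)}"
      have "norm (x - y) \<le> K * infnorm (x - y)" unfolding K_def by (rule norm_le_infnorm)
      also have "\<dots> \<le> K * (d / (2 * K))" using x K by (intro mult_left_mono) auto
      also have "\<dots> < d" using K d by simp
      finally have "dist (f x) (f y) < e" using d x by (simp add: dist_norm)
      then show "ereal (f y - e) \<le> ereal (f x)" by (simp add: dist_real_def)
    qed
    also have "\<dots> \<le> (SUP \<delta>\<in>{0<..}. ?I \<delta>)" using K d by (intro SUP_upper) auto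
    finally have "ereal (f y - e) + ereal e \<le> (SUP \<delta>\<in>{0<..}. ?I \<delta>) + ereal e"
      by (rule add_right_mono)
    then show "ereal (f y) \<le> (SUP \<delta>\<in>{0<..}. ?I \<delta>) + ereal e" by simp
  qed
qed

section \<open>Demand under a budget\<close>

text \<open>Once some bundle attains the maximum, the supremum in \<open>opt_utility\<close> can be
  replaced by direct comparison of bundles.\<close>

lemma demand_set_eq:
  assumes "x \<in> affordable p b" "\<And>y. y \<in> affordable p b \<Longrightarrow> v y - p y \<le> v x - p x"
  shows "demand_set p v b = {x \<in> affordable p b. \<forall>y\<in>affordable p b. v y - p y \<le> v x - p x}"
proof -
  have "opt_utility p v b = v x - p x"
    unfolding opt_utility_def using assms by (intro cSup_eq_maximum) auto
  then show ?thesis unfolding demand_set_def using assms by force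
qed

lemma linear_valuation_continuous: "continuous_on S (linear_valuation c)"
  unfolding linear_valuation_def by (intro continuous_intros)

text \<open>Lower continuity of the price makes the budget set closed in the compact cube and the
  utility upper semicontinuous.\<close>

lemma optimal_bundle_exists:
  fixes p v :: "real ^ 'm \<Rightarrow> real"
  assumes lsc: "lower_continuous p" and "p 0 = 0" "0 \<le> b" and cont: "continuous_on unit_cube v"
  obtains x where "x \<in> affordable p b" "\<And>y. y \<in> affordable p b \<Longrightarrow> v y - p y \<le> v x - p x"
proof (rule compact_attains_max_upper_semicontinuous[of "affordable p b" "\<lambda>x. v x - p x"])
  have "open (- affordable p b)"
  proof (subst open_subopen, intro ballI)
    fix y assume y: "y \<in> - affordable p b"
    show "\<exists>U. open U \<and> y \<in> U \<and> U \<subseteq> - affordable p b"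
    proof (cases "y \<in> unit_cube")
      case True
      then have "b < p y" using y by (auto simp: affordable_def)
      from lower_continuousD[OF lsc True this]
      obtain d where "0 < d" "\<And>x. x \<in> unit_cube \<Longrightarrow> dist x y < d \<Longrightarrow> b < p x" by blast
      then show ?thesis
        by (intro exI[of _ "ball y d"]) (force simp: affordable_def dist_commute)
    next
      case False
      then show ?thesis
        using compact_imp_closed[OF compact_unit_cube]
        by (intro exI[of _ "- unit_cube"]) (auto simp: affordable_def)
    qed
  qed
  then have "closed (affordable p b)" by (simp add: closed_def)
  moreover have "affordable p b \<inter> unit_cube = affordable p b" by (auto simp: affordable_def)
  ultimately show "compact (affordable p b)"
    using closed_Int_compact[OF _ compact_unit_cube, of "affordable p b"] by simp
  have "0 \<in> affordable p b" using assms by (auto simp: affordable_def zero_in_unit_cube)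
  then show "affordable p b \<noteq> {}" by auto
  fix y c assume "y \<in> affordable p b" and c: "v y - p y < c"
  then have y: "y \<in> unit_cube" by (auto simp: affordable_def)
  \<comment> \<open>Half of the slack is spent on the drop of the price, half on the change of the
    valuation.\<close>
  define e where "e = (c - (v y - p y)) / 2"
  have e: "0 < e" using c by (simp add: e_def)
  from lower_continuousD[OF lsc y, of "p y - e"] e
  obtain d where d: "0 < d" "\<And>x. x \<in> unit_cube \<Longrightarrow> dist x y < d \<Longrightarrow> p y - e < p x" by auto
  obtain d' where d': "0 < d'" "\<And>x. x \<in> unit_cube \<Longrightarrow> dist x y < d' \<Longrightarrow> dist (v x) (v y) < e"
    using cont y e unfolding continuous_on_iff by metis
  show "\<exists>U. open U \<and> y \<in> U \<and> (\<forall>x\<in>affordable p b \<inter> U. v x - p x < c)"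
  proof (intro exI[of _ "ball y (min d d')"] conjI ballI)
    fix x assume x: "x \<in> affordable p b \<inter> ball y (min d d')"
    then have "p y - e < p x" "dist (v x) (v y) < e"
      using d(2) d'(2) by (auto simp: affordable_def dist_commute)
    moreover have "c = v y - p y + e + e" by (simp add: e_def)
    ultimately show "v x - p x < c" unfolding dist_real_def by linarith
  qed (use d d' in auto)
qed (use that in blast)

text \<open>If the budget binds, a demanded bundle and the unconstrained optimum are joined by a segment
  on which the utility does not drop and on which some bundle exhausts the budget.\<close>

lemma revenue_ge_convex:
  fixes p :: "real ^ 'm \<Rightarrow> real"
  assumes cont: "continuous_on unit_cube p" and conv: "convex_on unit_cube p"
    and "p 0 = 0" "0 \<le> b"
    and z: "z \<in> unit_cube"
      "\<And>x. x \<in> unit_cube \<Longrightarrow> linear_valuation c x - p x \<le> linear_valuation c z - p z"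
  shows "min b (p z) \<le> revenue p (linear_valuation c) b"
proof -
  let ?v = "linear_valuation c"
  obtain x where x: "x \<in> affordable p b" "\<And>y. y \<in> affordable p b \<Longrightarrow> ?v y - p y \<le> ?v x - p x"
    using optimal_bundle_exists[OF continuous_on_imp_lower_continuous[OF cont] assms(3,4)
        linear_valuation_continuous[of _ c]] by blast
  have demand: "demand_set p ?v b
      = {x \<in> affordable p b. \<forall>y\<in>affordable p b. ?v y - p y \<le> ?v x - p x}"
    using x by (rule demand_set_eq)
  have "\<exists>y\<in>demand_set p ?v b. min b (p z) \<le> p y"
  proof (cases "p z \<le> b")
    case True
    then have "z \<in> demand_set p ?v b" unfolding demand using z by (auto simp: affordable_def)
    then show ?thesis by (intro bexI[of _ z]) auto
  next
    case False
    have xc: "x \<in> unit_cube" "p x \<le> b" using x by (auto simp: affordable_def)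
    define y where "y t = (1 - t) *\<^sub>R x + t *\<^sub>R z" for t :: real
    have y_cube: "y t \<in> unit_cube" if "0 \<le> t" "t \<le> 1" for t
      unfolding y_def using that xc z convex_unit_cube by (intro convexD_alt) auto
    have "continuous_on {0..1} (\<lambda>t. p (y t))"
      using y_cube by (intro continuous_on_compose2[OF cont]) (auto simp: y_def intro!: continuous_intros)
    moreover have "p (y 0) \<le> b" "b \<le> p (y 1)" using xc False by (auto simp: y_def)
    ultimately obtain t where t: "0 \<le> t" "t \<le> 1" "p (y t) = b"
      using IVT'[of "\<lambda>t. p (y t)" 0 b 1] by auto
    have v_y: "?v (y t) = (1 - t) * ?v x + t * ?v z"
      by (simp add: linear_valuation_def y_def sum_distrib_left sum.distrib[symmetric] algebra_simps)
    have p_y: "p (y t) \<le> (1 - t) * p x + t * p z"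
      unfolding y_def using t xc z by (intro convex_onD[OF conv]) auto
    \<comment> \<open>The valuation is linear and the price convex, so the utility along the segment
      is at least the interpolation of its end values. Optimality of \<open>z\<close> over the whole
      cube makes this at least the utility of \<open>x\<close>.\<close>
    have "t * (?v x - p x) \<le> t * (?v z - p z)" using t z xc by (intro mult_left_mono) auto
    then have "?v x - p x \<le> ?v (y t) - p (y t)" using v_y p_y by (simp add: algebra_simps)
    then have "y t \<in> demand_set p ?v b"
      unfolding demand using t y_cube x(2) by (fastforce simp: affordable_def)
    then show ?thesis using t by (intro bexI[of _ "y t"]) auto
  qed
  then obtain y where y: "y \<in> demand_set p ?v b" "min b (p z) \<le> p y" by blast
  have "bdd_above (p ` demand_set p ?v b)"
    by (rule bdd_aboveI[of _ b]) (auto simp: demand_set_def affordable_def)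
  then have "p y \<le> revenue p ?v b"
    unfolding revenue_def using y by (intro cSUP_upper) auto
  with y show ?thesis by linarith
qed

section \<open>Demand in a single component\<close>

definition lower_semicont_unit :: "(real \<Rightarrow> real) \<Rightarrow> bool" where
  "lower_semicont_unit h \<longleftrightarrow>
     (\<forall>y\<in>{0..1}. \<forall>c<h y. \<exists>\<delta>>0. \<forall>x\<in>{0..1}. dist x y < \<delta> \<longrightarrow> c < h x)"

text \<open>The strict clause breaks ties upwards: \<open>X\<close> is the largest maximizer, so
  reducing any larger quantity to \<open>X\<close> is a strict gain.\<close>

definition greatest_demand :: "(real \<Rightarrow> real) \<Rightarrow> real \<Rightarrow> real \<Rightarrow> bool" where
  "greatest_demand h s X \<longleftrightarrow> X \<in> {0..1} \<and>
     (\<forall>t\<in>{0..1}. s * t - h t \<le> s * X - h X \<and> (X < t \<longrightarrow> s * t - h t < s * X - h X))"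

text \<open>The summands of a separable function are determined only up to constants. Restricting
  \<open>q\<close> to the coordinate axes picks the normalized ones, and since the axes are embedded
  isometrically and monotonically, both properties of \<open>q\<close> carry over.\<close>

lemma separable_components:
  fixes q :: "real ^ 'm \<Rightarrow> real"
  assumes "separable_MLC_pricing q"
  obtains h where "\<And>x. x \<in> unit_cube \<Longrightarrow> q x = (\<Sum>j\<in>UNIV. h j (x $ j))"
    "\<And>j. h j 0 = 0" "\<And>j. mono_on {0..1} (h j)" "\<And>j. lower_semicont_unit (h j)"
proof -
  from assms have q: "mono_on unit_cube q" "lower_continuous q" "q 0 = 0"
    by (auto simp: separable_MLC_pricing_def pricing_function_def MLC_def)
  from assms obtain g where g: "\<And>x. x \<in> unit_cube \<Longrightarrow> q x = (\<Sum>j\<in>UNIV. g j (x $ j))"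
    by (auto simp: separable_MLC_pricing_def separable_def)
  have ax: "axis j t \<in> unit_cube" if "t \<in> {0..1}" for j :: 'm and t :: real
    using that by (auto simp: unit_cube_def axis_def)
  have g0: "(\<Sum>j\<in>UNIV. g j 0) = 0" using g[of 0] q zero_in_unit_cube by simp
  have q_axis: "q (axis j t) = g j t - g j 0" if "t \<in> {0..1}" for j t
  proof -
    have "q (axis j t) = (\<Sum>k\<in>UNIV. g k (axis j t $ k))" using g ax that by blast
    also have "\<dots> = g j t + (\<Sum>k\<in>UNIV - {j}. g k 0)"
      by (subst sum.remove[of _ j]) (auto simp: axis_def intro!: sum.cong)
    also have "(\<Sum>k\<in>UNIV - {j}. g k 0) = - g j 0"
      using g0 by (subst (asm) sum.remove[of _ j]) auto
    finally show ?thesis by simp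
  qed
  have dist_axis: "dist (axis j s) (axis j t) = dist s t" for j :: 'm and s t :: real
  proof -
    have "axis j s - axis j t = (s - t) *\<^sub>R (axis j 1 :: real ^ 'm)"
      by (simp add: vec_eq_iff axis_def)
    then show ?thesis by (simp add: dist_norm norm_axis_1)
  qed
  show thesis
  proof (rule that[of "\<lambda>j t. q (axis j t)"])
    fix x :: "real ^ 'm" assume x: "x \<in> unit_cube"
    then have "(\<Sum>j\<in>UNIV. q (axis j (x $ j))) = (\<Sum>j\<in>UNIV. g j (x $ j) - g j 0)"
      by (intro sum.cong q_axis) (auto simp: unit_cube_def)
    then show "q x = (\<Sum>j\<in>UNIV. q (axis j (x $ j)))" using g[OF x] g0 by (simp add: sum_subtractf)
  next
    fix j :: 'm
    show "q (axis j 0) = 0" using q_axis[of 0 j] by simp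
    show "mono_on {0..1} (\<lambda>t. q (axis j t))"
    proof (rule mono_onI)
      fix s t :: real assume st: "s \<in> {0..1}" "t \<in> {0..1}" "s \<le> t"
      then have "axis j s \<le> (axis j t :: real ^ 'm)" by (simp add: less_eq_vec_def axis_def)
      then show "q (axis j s) \<le> q (axis j t)" using st ax q(1) by (meson mono_onD)
    qed
    show "lower_semicont_unit (\<lambda>t. q (axis j t))"
      unfolding lower_semicont_unit_def
    proof (intro ballI allI impI)
      fix y c :: real assume "y \<in> {0..1}" "c < q (axis j y)"
      with lower_continuousD[OF q(2) ax] obtain d where
        "0 < d" "\<And>x. x \<in> unit_cube \<Longrightarrow> dist x (axis j y) < d \<Longrightarrow> c < q x" by blast
      then show "\<exists>d>0. \<forall>x\<in>{0..1}. dist x y < d \<longrightarrow> c < q (axis j x)"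
        using ax dist_axis by auto
    qed
  qed
qed

text \<open>The supremum of the set of maximizers is again a maximizer: for a maximizer
  \<open>a\<close> close below it, \<open>h a\<close> exceeds \<open>h (Sup A) - e\<close> by lower
  semicontinuity, while \<open>s * a \<le> s * Sup A\<close>.\<close>

lemma greatest_demand_exists:
  assumes mono: "mono_on {0..1} h" and lsc: "lower_semicont_unit h" and s: "0 \<le> s"
  shows "\<exists>X. greatest_demand h s X"
proof -
  let ?u = "\<lambda>t. s * t - h t"
  have "\<exists>x\<in>{0..1}. \<forall>y\<in>{0..1}. ?u y \<le> ?u x"
  proof (rule compact_attains_max_upper_semicontinuous[of "{0..1}" ?u])
    fix y c assume y: "y \<in> {0..1::real}" and c: "?u y < c"
    define e where "e = (c - ?u y) / 2"
    have e: "0 < e" using c by (simp add: e_def)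
    then obtain d where d: "0 < d" "\<And>x. x \<in> {0..1} \<Longrightarrow> dist x y < d \<Longrightarrow> h y - e < h x"
      using lsc y unfolding lower_semicont_unit_def
      by (metis diff_less_eq less_add_same_cancel1)
    \<comment> \<open>The bound \<open>e / (s + 1)\<close> keeps the change of \<open>s * x\<close>
      at most \<open>e\<close>; the added 1 covers \<open>s = 0\<close>.\<close>
    define d' where "d' = min d (e / (s + 1))"
    have d': "0 < d'" using d e s by (simp add: d'_def)
    show "\<exists>U. open U \<and> y \<in> U \<and> (\<forall>x\<in>{0..1} \<inter> U. ?u x < c)"
    proof (intro exI[of _ "ball y d'"] conjI ballI)
      fix x assume x: "x \<in> {0..1} \<inter> ball y d'"
      then have "h y - e < h x" using d by (auto simp: d'_def dist_commute)
      moreover have "s * (x - y) \<le> s * (e / (s + 1))"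
        using x s by (intro mult_left_mono) (auto simp: d'_def dist_real_def)
      moreover have "s * (e / (s + 1)) \<le> e" using s e by (simp add: field_simps)
      moreover have "c = ?u y + e + e" by (simp add: e_def field_simps)
      ultimately show "?u x < c" unfolding right_diff_distrib by linarith
    qed (use d' in auto)
  next
    fix x assume "x \<in> {0..1}" "\<And>y. y \<in> {0..1} \<Longrightarrow> ?u y \<le> ?u x"
    then show "\<exists>x\<in>{0..1}. \<forall>y\<in>{0..1}. ?u y \<le> ?u x" by blast
  qed auto
  then obtain x where x: "x \<in> {0..1}" "\<And>y. y \<in> {0..1} \<Longrightarrow> ?u y \<le> ?u x" by blast
  define A where "A = {t \<in> {0..1}. ?u t = ?u x}"
  have A: "x \<in> A" "bdd_above A" "A \<subseteq> {0..1}"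
    using x by (auto simp: A_def intro: bdd_aboveI[of _ 1])
  have X: "Sup A \<in> {0..1}"
    using A x(1) cSup_upper[of x A] cSup_least[of A 1] by fastforce
  have "?u x \<le> ?u (Sup A)"
  proof (rule field_le_epsilon)
    fix e :: real assume "0 < e"
    then obtain d where d: "0 < d" "\<And>y. y \<in> {0..1} \<Longrightarrow> dist y (Sup A) < d \<Longrightarrow> h (Sup A) - e < h y"
      using lsc X unfolding lower_semicont_unit_def
      by (metis diff_less_eq less_add_same_cancel1)
    have "Sup A - d < Sup A" using d by simp
    then obtain a where a: "a \<in> A" "Sup A - d < a" using A less_cSupE[of "Sup A - d" A] by blast
    have "a \<le> Sup A" using a A by (intro cSup_upper)
    then have "h (Sup A) - e < h a" using a A d by (auto simp: dist_real_def)
    moreover have "s * a \<le> s * Sup A" using \<open>a \<le> Sup A\<close> s by (intro mult_left_mono)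
    moreover have "?u x = ?u a" using a by (simp add: A_def)
    ultimately show "?u x \<le> ?u (Sup A) + e" by linarith
  qed
  then have opt: "?u t \<le> ?u (Sup A)" if "t \<in> {0..1}" for t using x that by force
  have "?u t < ?u (Sup A)" if t: "t \<in> {0..1}" "Sup A < t" for t
  proof -
    have "t \<notin> A" using t A cSup_upper[of t A] by auto
    then have "?u t \<noteq> ?u x" using t by (simp add: A_def)
    then show ?thesis using x(2)[OF t(1)] \<open>?u x \<le> ?u (Sup A)\<close> by linarith
  qed
  then show ?thesis unfolding greatest_demand_def using X opt by blast
qed

text \<open>A buyer never demands more than the greatest unconstrained demand in a component: shrinking
  that coordinate would be both cheaper and strictly better.\<close>

lemma revenue_le_separable:
  fixes q :: "real ^ 'm \<Rightarrow> real"
  assumes lsc: "lower_continuous q" and "q 0 = 0" "0 \<le> b"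
    and sep: "\<And>x. x \<in> unit_cube \<Longrightarrow> q x = (\<Sum>j\<in>UNIV. h j (x $ j))"
    and mono: "\<And>j. mono_on {0..1} (h j)"
    and X: "\<And>j. greatest_demand (h j) (c j) (X j)"
  shows "revenue q (linear_valuation c) b \<le> min b (\<Sum>j\<in>UNIV. h j (X j))"
proof -
  let ?v = "linear_valuation c"
  obtain x0 where x0: "x0 \<in> affordable q b" "\<And>y. y \<in> affordable q b \<Longrightarrow> ?v y - q y \<le> ?v x0 - q x0"
    using optimal_bundle_exists[OF assms(1-3) linear_valuation_continuous[of _ c]] by blast
  have demand: "demand_set q ?v b
      = {x \<in> affordable q b. \<forall>y\<in>affordable q b. ?v y - q y \<le> ?v x - q x}"
    using x0 by (rule demand_set_eq)
  have "q x \<le> min b (\<Sum>j\<in>UNIV. h j (X j))" if "x \<in> demand_set q ?v b" for x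
  proof -
    have x: "x \<in> unit_cube" "q x \<le> b" "\<And>y. y \<in> affordable q b \<Longrightarrow> ?v y - q y \<le> ?v x - q x"
      using that by (auto simp: demand affordable_def)
    have x01: "x $ j \<in> {0..1}" for j using x by (auto simp: unit_cube_def)
    have "h j (x $ j) \<le> h j (X j)" for j
    proof (cases "x $ j \<le> X j")
      case True
      then show ?thesis using mono_onD[OF mono x01] X[of j] by (auto simp: greatest_demand_def)
    next
      case False
      define y where "y = (\<chi> k. if k = j then X j else x $ k)"
      have y: "y \<in> unit_cube"
        using X[of j] x01 by (auto simp: unit_cube_def y_def greatest_demand_def)
      \<comment> \<open>Price and valuation are both coordinate sums, so the change of bundle
        affects only their terms at \<open>j\<close>.\<close>
      have split: "(\<Sum>k\<in>UNIV. f k (y $ k)) = (\<Sum>k\<in>UNIV. f k (x $ k)) - f j (x $ j) + f j (X j)"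
        for f :: "'m \<Rightarrow> real \<Rightarrow> real"
        by (simp add: sum.remove[of UNIV j] y_def)
      have "h j (X j) \<le> h j (x $ j)"
        using False mono_onD[OF mono _ x01, of "X j"] X[of j] by (auto simp: greatest_demand_def)
      then have "q y \<le> b" using x sep[OF x(1)] sep[OF y] split[of h] by simp
      then have "?v y - q y \<le> ?v x - q x" using x y by (auto simp: affordable_def)
      moreover have "c j * x $ j - h j (x $ j) < c j * X j - h j (X j)"
        using False X[of j] x01 by (auto simp: greatest_demand_def)
      ultimately have False
        using sep[OF x(1)] sep[OF y] split[of h] split[of "\<lambda>j t. c j * t"]
        by (simp add: linear_valuation_def)
      then show ?thesis ..
    qed
    then show ?thesis using x sep[OF x(1)] by (auto intro: sum_mono)
  qed
  moreover have "demand_set q ?v b \<noteq> {}" using x0 by (auto simp: demand)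
  ultimately show ?thesis unfolding revenue_def by (intro cSUP_least)
qed

subsection \<open>Optimal segment lengths\<close>

text \<open>Gaussian elimination, by induction on the set of equations: each equation is either
  trivial on \<open>S\<close> or eliminates one unknown.\<close>

lemma underdetermined_system_nontrivial_solution:
  fixes a :: "'i \<Rightarrow> 'e \<Rightarrow> 'f::field"
  assumes "finite I" "finite S" "card I < card S"
  shows "\<exists>d. (\<exists>e\<in>S. d e \<noteq> 0) \<and> (\<forall>e. e \<notin> S \<longrightarrow> d e = 0) \<and> (\<forall>k\<in>I. (\<Sum>e\<in>S. a k e * d e) = 0)"
  using assms
proof (induction I arbitrary: S a rule: finite_induct)
  case empty
  then have "S \<noteq> {}" by auto
  then obtain e where "e \<in> S" by auto
  then show ?case by (intro exI[of _ "\<lambda>x. if x = e then 1 else 0"]) auto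
next
  case (insert i I)
  show ?case
  proof (cases "\<exists>e\<in>S. a i e \<noteq> 0")
    case False
    have "card I < card S" using insert by simp
    from insert.IH[OF insert.prems(1) this, of a]
    obtain d where d: "\<exists>e\<in>S. d e \<noteq> 0" "\<forall>e. e \<notin> S \<longrightarrow> d e = 0"
      "\<forall>k\<in>I. (\<Sum>e\<in>S. a k e * d e) = 0" by blast
    moreover have "(\<Sum>e\<in>S. a i e * d e) = 0" using False by (intro sum.neutral) simp
    ultimately show ?thesis by blast
  next
    case True
    then obtain p where p: "p \<in> S" "a i p \<noteq> 0" by blast
    \<comment> \<open>Solving equation \<open>i\<close> for the unknown \<open>p\<close> and
      substituting gives these coefficients.\<close>
    define a' where "a' k e = a k e - a k p * a i e / a i p" for k e
    have "finite (S - {p})" "card I < card (S - {p})" using insert p by auto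
    from insert.IH[OF this, of a'] obtain d where d: "\<exists>e\<in>S - {p}. d e \<noteq> 0"
      "\<forall>e. e \<notin> S - {p} \<longrightarrow> d e = 0" "\<forall>k\<in>I. (\<Sum>e\<in>S - {p}. a' k e * d e) = 0" by blast
    \<comment> \<open>The value at \<open>p\<close> is the one forced by equation
      \<open>i\<close>.\<close>
    define d' where "d' = d(p := - (\<Sum>e\<in>S - {p}. a i e * d e) / a i p)"
    have sum: "(\<Sum>e\<in>S. a k e * d' e) = (\<Sum>e\<in>S - {p}. a' k e * d e)" for k
    proof -
      have "(\<Sum>e\<in>S. a k e * d' e) = a k p * d' p + (\<Sum>e\<in>S - {p}. a k e * d' e)"
        using p insert.prems by (intro sum.remove) auto
      also have "(\<Sum>e\<in>S - {p}. a k e * d' e) = (\<Sum>e\<in>S - {p}. a k e * d e)"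
        by (intro sum.cong) (auto simp: d'_def)
      also have "a k p * d' p = - (\<Sum>e\<in>S - {p}. a k p * a i e / a i p * d e)"
        by (simp add: d'_def sum_distrib_left sum_divide_distrib mult.assoc)
      also have "- (\<Sum>e\<in>S - {p}. a k p * a i e / a i p * d e) + (\<Sum>e\<in>S - {p}. a k e * d e)
          = (\<Sum>e\<in>S - {p}. a' k e * d e)"
        by (simp add: a'_def left_diff_distrib sum_subtractf)
      finally show ?thesis .
    qed
    have "(\<Sum>e\<in>S. a i e * d' e) = 0"
      unfolding sum using p by (intro sum.neutral) (simp add: a'_def)
    then show ?thesis
      using d p sum by (intro exI[of _ d']) (auto simp: d'_def)
  qed
qed

text \<open>Incentive compatibility bounds the increase of the payment from one slope to the next by the
  increase of the demand priced at the larger slope.\<close>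

lemma incentive_compatible_weights:
  fixes T :: "real set" and X Q :: "real \<Rightarrow> real"
  assumes "finite T" and "\<And>t. t \<in> T \<Longrightarrow> 0 \<le> X t"
    and "\<And>t. t \<in> T \<Longrightarrow> Q t \<le> t * X t"
    and "\<And>s t. s \<in> T \<Longrightarrow> t \<in> T \<Longrightarrow> s * X t - Q t \<le> s * X s - Q s"
  shows "\<exists>w. (\<forall>t\<in>T. 0 \<le> w t \<and> (\<Sum>s\<in>{s \<in> T. s \<le> t}. w s) = X t
      \<and> Q t \<le> (\<Sum>s\<in>{s \<in> T. s \<le> t}. s * w s))"
  using assms
proof (induction T rule: finite_linorder_max_induct)
  case empty
  then show ?case by auto
next
  case (insert m T)
  have "\<exists>w. (\<forall>t\<in>T. 0 \<le> w t \<and> (\<Sum>s\<in>{s \<in> T. s \<le> t}. w s) = X t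
      \<and> Q t \<le> (\<Sum>s\<in>{s \<in> T. s \<le> t}. s * w s))"
    using insert.prems by (intro insert.IH) auto
  then obtain w where w: "\<And>t. t \<in> T \<Longrightarrow> 0 \<le> w t"
      "\<And>t. t \<in> T \<Longrightarrow> (\<Sum>s\<in>{s \<in> T. s \<le> t}. w s) = X t"
      "\<And>t. t \<in> T \<Longrightarrow> Q t \<le> (\<Sum>s\<in>{s \<in> T. s \<le> t}. s * w s)"
    by blast
  \<comment> \<open>The new largest slope \<open>m\<close> receives the missing demand
    \<open>X m - sum w T\<close>; this must be nonnegative and pay for \<open>Q m\<close>. With no
    smaller slope, \<open>Q m \<le> m * X m\<close> suffices.\<close>
  have "sum w T \<le> X m \<and> Q m \<le> (\<Sum>s\<in>T. s * w s) + m * (X m - sum w T)"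
  proof (cases "T = {}")
    case True
    then show ?thesis using insert.prems by simp
  next
    case False
    define r where "r = Max T"
    have r: "r \<in> T" using False insert.hyps by (simp add: r_def)
    have "{s \<in> T. s \<le> r} = T" using insert.hyps by (auto simp: r_def)
    with w(2,3)[OF r] have *: "sum w T = X r" "Q r \<le> (\<Sum>s\<in>T. s * w s)" by auto
    \<comment> \<open>The first inequality bounds the growth of \<open>Q\<close> by \<open>m\<close>
      times the growth of \<open>X\<close>; adding the second shows that \<open>X\<close>
      grows.\<close>
    have ic: "m * X r - Q r \<le> m * X m - Q m" "r * X m - Q m \<le> r * X r - Q r"
      using insert.prems(3) r by auto
    then have "0 \<le> (m - r) * (X m - X r)" by (simp add: algebra_simps)
    moreover have "0 < m - r" using insert.hyps r by auto
    ultimately have "X r \<le> X m" by (simp add: zero_le_mult_iff)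
    then show ?thesis using * ic by (simp add: algebra_simps)
  qed
  note last = this
  define w' where "w' = w(m := X m - sum w T)"
  have m: "m \<notin> T" using insert.hyps by auto
  have sum_T: "(\<Sum>s\<in>A. f s * w' s) = (\<Sum>s\<in>A. f s * w s)" if "A \<subseteq> T" for A and f :: "real \<Rightarrow> real"
    using that m by (intro sum.cong) (auto simp: w'_def)
  have "0 \<le> w' t \<and> (\<Sum>s\<in>{s \<in> insert m T. s \<le> t}. w' s) = X t
      \<and> Q t \<le> (\<Sum>s\<in>{s \<in> insert m T. s \<le> t}. s * w' s)" if t: "t \<in> insert m T" for t
  proof (cases "t = m")
    case True
    have *: "{s \<in> insert m T. s \<le> m} = insert m T" using insert.hyps by auto
    have "(\<Sum>s\<in>insert m T. f s * w' s) = f m * (X m - sum w T) + (\<Sum>s\<in>T. f s * w s)"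
      for f :: "real \<Rightarrow> real"
      using m insert.hyps sum_T[of T f] by (simp add: w'_def)
    from this[of "\<lambda>_. 1"] this[of "\<lambda>s. s"] show ?thesis
      unfolding True * using last by (simp add: w'_def)
  next
    case False
    then have t: "t \<in> T" "t < m" using t insert.hyps by auto
    then have *: "{s \<in> insert m T. s \<le> t} = {s \<in> T. s \<le> t}" by auto
    have "w' t = w t" using False by (simp add: w'_def)
    then show ?thesis
      unfolding * using w t sum_T[of "{s \<in> T. s \<le> t}" "\<lambda>_. 1"] sum_T[of "{s \<in> T. s \<le> t}" "\<lambda>s. s"]
      by simp
  qed
  then show ?case by blast
qed

text \<open>Each demand is optimal at its own slope, so the pairs of demand and price are incentive
  compatible. The resulting weights describe a convex price whose payments dominate those of
  \<open>h\<close>.\<close>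

lemma dominating_slope_weights:
  assumes "finite T" "T \<noteq> {}" and nonneg: "\<And>t. t \<in> T \<Longrightarrow> 0 \<le> t"
    and h: "h 0 = 0" and X: "\<And>t. t \<in> T \<Longrightarrow> greatest_demand h t (X t)"
  obtains w where "\<And>t. t \<in> T \<Longrightarrow> 0 \<le> w t" "sum w T = 1"
    "\<And>t. t \<in> T \<Longrightarrow> h (X t) \<le> (\<Sum>s\<in>{s \<in> T. s \<le> t}. s * w s)"
proof -
  have X01: "0 \<le> X t" "X t \<le> 1" and opt: "\<And>x. x \<in> {0..1} \<Longrightarrow> t * x - h x \<le> t * X t - h (X t)"
    if "t \<in> T" for t using X[OF that] by (auto simp: greatest_demand_def)
  have "h (X t) \<le> t * X t" if "t \<in> T" for t using opt[OF that, of 0] h by simp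
  then have "\<exists>w. (\<forall>t\<in>T. 0 \<le> w t \<and> (\<Sum>s\<in>{s \<in> T. s \<le> t}. w s) = X t
      \<and> h (X t) \<le> (\<Sum>s\<in>{s \<in> T. s \<le> t}. s * w s))"
    using assms(1) X01 opt by (intro incentive_compatible_weights) auto
  then obtain w where w: "\<And>t. t \<in> T \<Longrightarrow> 0 \<le> w t"
      "\<And>t. t \<in> T \<Longrightarrow> (\<Sum>s\<in>{s \<in> T. s \<le> t}. w s) = X t"
      "\<And>t. t \<in> T \<Longrightarrow> h (X t) \<le> (\<Sum>s\<in>{s \<in> T. s \<le> t}. s * w s)"
    by blast
  define m where "m = Max T"
  have m: "m \<in> T" "{s \<in> T. s \<le> m} = T" using assms(1,2) by (auto simp: m_def)
  \<comment> \<open>The undemanded remainder \<open>1 - X m\<close> goes to the greatest slope,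
    which normalizes the weights and, slopes being nonnegative, lowers no payment.\<close>
  define w' where "w' = w(m := w m + (1 - X m))"
  have ge: "w s \<le> w' s" if "s \<in> T" for s using X01[OF m(1)] by (simp add: w'_def)
  show thesis
  proof (rule that)
    show "0 \<le> w' t" if "t \<in> T" for t using w(1)[OF that] ge[OF that] by simp
    have "sum w' T = w' m + sum w' (T - {m})" using m assms(1) by (intro sum.remove) auto
    also have "sum w' (T - {m}) = sum w (T - {m})" by (intro sum.cong) (auto simp: w'_def)
    also have "w' m + sum w (T - {m}) = sum w T + (1 - X m)"
      using m assms(1) by (simp add: w'_def sum.remove[of T m w])
    finally show "sum w' T = 1" using w(2)[OF m(1)] m by simp
    show "h (X t) \<le> (\<Sum>s\<in>{s \<in> T. s \<le> t}. s * w' s)" if "t \<in> T" for t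
    proof -
      have "(\<Sum>s\<in>{s \<in> T. s \<le> t}. s * w s) \<le> (\<Sum>s\<in>{s \<in> T. s \<le> t}. s * w' s)"
        using ge nonneg by (intro sum_mono mult_left_mono) auto
      then show ?thesis using w(3)[OF that] by linarith
    qed
  qed
qed

section \<open>The product of simplices\<close>

text \<open>One simplex for each dataset. Weights are functions on all pairs, set to 0 outside
  \<open>T\<close>, which keeps supports finite for finite \<open>T\<close> and the set compact in
  the product topology.\<close>

definition feasible_weights :: "real set \<Rightarrow> ('m::finite \<times> real \<Rightarrow> real) \<Rightarrow> bool" where
  "feasible_weights T y \<longleftrightarrow> (\<forall>e. 0 \<le> y e) \<and> (\<forall>j t. t \<notin> T \<longrightarrow> y (j, t) = 0)
     \<and> (\<forall>j. (\<Sum>t\<in>T. y (j, t)) = 1)"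

text \<open>The unconstrained payment of a buyer with slopes \<open>c\<close>, who buys all segments
  of slope at most \<open>c j\<close>. The conditional coefficient displays it as a linear form in
  \<open>y\<close>.\<close>

definition payment :: "real set \<Rightarrow> ('m::finite \<Rightarrow> real) \<Rightarrow> ('m \<times> real \<Rightarrow> real) \<Rightarrow> real" where
  "payment T c y = (\<Sum>j\<in>UNIV. \<Sum>t\<in>T. (if t \<le> c j then t else 0) * y (j, t))"

lemma payment_eq:
  assumes "finite T"
  shows "payment T c y = (\<Sum>j\<in>UNIV. \<Sum>t\<in>{t \<in> T. t \<le> c j}. t * y (j, t))"
  unfolding payment_def sum.inter_filter[OF assms] by (intro sum.cong) auto

lemma feasible_weights_slope_weights:
  assumes "finite T" "T \<noteq> {}" "\<And>t. t \<in> T \<Longrightarrow> 0 \<le> t" "feasible_weights T y"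
  shows "slope_weights T (\<lambda>t. y (j, t))"
  using assms by unfold_locales (auto simp: feasible_weights_def)

text \<open>A closed part, cut out by the normalizations, of a box that is compact by Tychonoff's
  theorem.\<close>

lemma compact_feasible_weights:
  assumes "finite T"
  shows "compact {y :: 'm::finite \<times> real \<Rightarrow> real. feasible_weights T y}"
proof -
  define B where "B = (\<lambda>(j :: 'm, t). if t \<in> T then {0..1} else {0 :: real})"
  have "compactin (product_topology (\<lambda>_. euclidean) UNIV) (PiE UNIV B)"
    unfolding compactin_PiE by (auto simp: B_def)
  then have comp: "compact (PiE UNIV B)" by (simp add: euclidean_product_topology)
  have le1: "y (j, t) \<le> 1" if "feasible_weights T y" "t \<in> T" for y j and t :: real
  proof -
    have "y (j, t) \<le> (\<Sum>t\<in>T. y (j, t))"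
      using that assms by (intro member_le_sum) (auto simp: feasible_weights_def)
    then show ?thesis using that by (simp add: feasible_weights_def)
  qed
  have "{y :: 'm \<times> real \<Rightarrow> real. feasible_weights T y}
      = PiE UNIV B \<inter> (\<Inter>j. {y. (\<Sum>t\<in>T. y (j, t)) = 1})"
  proof (intro set_eqI iffI)
    fix y :: "'m \<times> real \<Rightarrow> real"
    assume y: "y \<in> {y. feasible_weights T y}"
    then have "y e \<in> B e" for e
      using le1[of y "snd e" "fst e"] by (cases e) (simp add: B_def feasible_weights_def)
    then show "y \<in> PiE UNIV B \<inter> (\<Inter>j. {y. (\<Sum>t\<in>T. y (j, t)) = 1})"
      using y by (simp add: PiE_iff feasible_weights_def)
  next
    fix y :: "'m \<times> real \<Rightarrow> real"
    assume y: "y \<in> PiE UNIV B \<inter> (\<Inter>j. {y. (\<Sum>t\<in>T. y (j, t)) = 1})"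
    then have B: "y (j, t) \<in> B (j, t)" for j t by (simp add: PiE_iff)
    have "0 \<le> y (j, t)" for j t using B[of j t] by (simp add: B_def split: if_splits)
    moreover have "y (j, t) = 0" if "t \<notin> T" for j t using B[of j t] that by (simp add: B_def)
    ultimately show "y \<in> {y. feasible_weights T y}" using y by (simp add: feasible_weights_def)
  qed
  moreover have "closed (\<Inter>j. {y :: 'm \<times> real \<Rightarrow> real. (\<Sum>t\<in>T. y (j, t)) = 1})"
    by (intro closed_INT ballI closed_Collect_eq continuous_intros continuous_on_product_coordinates)
  ultimately show ?thesis using compact_Int_closed[OF comp] by simp
qed

lemma optimal_weights_exist:
  fixes b :: "nat \<Rightarrow> real" and \<tau> :: "nat \<Rightarrow> 'm::finite \<Rightarrow> real"
  assumes "finite T" "T \<noteq> {}"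
  obtains y where "feasible_weights T y"
    "\<And>z. feasible_weights T z \<Longrightarrow>
      (\<Sum>i\<in>I. min (b i) (payment T (\<tau> i) z)) \<le> (\<Sum>i\<in>I. min (b i) (payment T (\<tau> i) y))"
proof -
  obtain t where "t \<in> T" using assms by auto
  then have "feasible_weights T (\<lambda>(j :: 'm, s). if s = t then 1 else 0)"
    using assms by (auto simp: feasible_weights_def)
  then have ne: "{y :: 'm \<times> real \<Rightarrow> real. feasible_weights T y} \<noteq> {}" by blast
  have "continuous_on A (\<lambda>y :: 'm \<times> real \<Rightarrow> real. \<Sum>i\<in>I. min (b i) (payment T (\<tau> i) y))" for A
    unfolding payment_def
    by (intro continuous_intros continuous_on_subset[OF continuous_on_product_coordinates]) auto
  from continuous_attains_sup[OF compact_feasible_weights[OF assms(1)] ne this]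
  show thesis using that by auto
qed

text \<open>With more positive weights than the \<open>m\<close> normalizations and \<open>n\<close>
  payments together, some nonzero direction within the support preserves all of these. Moving along
  it until a weight vanishes shrinks the support.\<close>

lemma reduce_support:
  fixes y :: "'m::finite \<times> real \<Rightarrow> real" and \<tau> :: "nat \<Rightarrow> 'm \<Rightarrow> real"
  assumes T: "finite T" and y: "feasible_weights T y"
    and card: "CARD('m) + n < card {e. y e \<noteq> 0}"
  obtains z where "feasible_weights T z" "\<And>i. i \<in> {1..n} \<Longrightarrow> payment T (\<tau> i) z = payment T (\<tau> i) y"
    "card {e. z e \<noteq> 0} < card {e. y e \<noteq> 0}"
proof -
  define S where "S = {e. y e \<noteq> 0}"
  have S: "S \<subseteq> UNIV \<times> T" using y by (force simp: S_def feasible_weights_def)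
  have finS: "finite S" using S T by (meson finite finite_SigmaI finite_subset)
  have y0: "0 \<le> y e" for e using y unfolding feasible_weights_def by blast
  \<comment> \<open>The row \<open>Inl j\<close> is the normalization of dataset \<open>j\<close>,
    the row \<open>Inr i\<close> the payment of buyer \<open>i\<close>.\<close>
  define a :: "'m + nat \<Rightarrow> 'm \<times> real \<Rightarrow> real" where
    "a k e = (case k of Inl j \<Rightarrow> of_bool (fst e = j)
       | Inr i \<Rightarrow> if snd e \<le> \<tau> i (fst e) then snd e else 0)" for k e
  have "card ((UNIV :: 'm set) <+> {1..n}) < card S"
    using card by (simp add: card_Plus S_def)
  from underdetermined_system_nontrivial_solution[OF _ finS this, of a]
  obtain d where d: "\<exists>e\<in>S. d e \<noteq> 0" "\<And>e. e \<notin> S \<Longrightarrow> d e = 0"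
    "\<And>k. k \<in> UNIV <+> {1..n} \<Longrightarrow> (\<Sum>e\<in>S. a k e * d e) = 0" by auto
  have ad: "(\<Sum>j\<in>UNIV. \<Sum>t\<in>T. a k (j, t) * d (j, t)) = 0" if "k \<in> UNIV <+> {1..n}" for k
  proof -
    have "(\<Sum>j\<in>UNIV. \<Sum>t\<in>T. a k (j, t) * d (j, t)) = (\<Sum>e\<in>UNIV \<times> T. a k e * d e)"
      by (simp add: sum.cartesian_product)
    also have "\<dots> = (\<Sum>e\<in>S. a k e * d e)"
      using S T d(2) by (intro sum.mono_neutral_right) auto
    finally show ?thesis using d(3)[OF that] by simp
  qed
  have d_sum: "(\<Sum>t\<in>T. d (j, t)) = 0" for j
  proof -
    have "(\<Sum>t\<in>T. a (Inl j) (k, t) * d (k, t)) = (if k = j then \<Sum>t\<in>T. d (k, t) else 0)" for k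
      by (simp add: a_def)
    then show ?thesis using ad[of "Inl j"] by (simp add: InlI)
  qed
  have d_pay: "payment T (\<tau> i) d = 0" if "i \<in> {1..n}" for i
    using ad[OF InrI[OF that]] by (simp add: payment_def a_def cong: if_cong)
  \<comment> \<open>A nonzero direction without negative entries would raise the total weight of
    some dataset.\<close>
  have "\<exists>e\<in>S. d e < 0"
  proof (rule ccontr)
    assume "\<not> ?thesis"
    then have d0: "0 \<le> d e" for e using d(2)[of e] by (cases "e \<in> S") force+
    obtain j t where jt: "(j, t) \<in> S" "d (j, t) \<noteq> 0" using d(1) by auto
    then have "0 < d (j, t)" using d0[of "(j, t)"] by simp
    then have "0 < (\<Sum>t\<in>T. d (j, t))"
      using jt S T d0 by (intro sum_pos2[of _ t]) auto
    then show False using d_sum by simp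
  qed
  define N where "N = {e \<in> S. d e < 0}"
  have N: "finite N" "N \<noteq> {}" using finS \<open>\<exists>e\<in>S. d e < 0\<close> by (auto simp: N_def)
  \<comment> \<open>The ratio test: the largest step that keeps all weights nonnegative, at which
    the weight of a minimizing index becomes 0.\<close>
  define \<epsilon> where "\<epsilon> = Min ((\<lambda>e. y e / - d e) ` N)"
  have "\<epsilon> \<in> (\<lambda>e. y e / - d e) ` N" unfolding \<epsilon>_def using N by (intro Min_in) auto
  then obtain p where p: "p \<in> N" "\<epsilon> = y p / - d p" by blast
  have \<epsilon>_le: "\<epsilon> \<le> y e / - d e" if "e \<in> N" for e
    unfolding \<epsilon>_def using N that by (intro Min_le) auto
  have \<epsilon>0: "0 \<le> \<epsilon>" using p y0[of p] by (simp add: N_def divide_nonneg_neg)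
  define z where "z e = y e + \<epsilon> * d e" for e
  have z_sum: "(\<Sum>t\<in>T. z (j, t)) = 1" for j
    using y d_sum[of j]
    by (simp add: z_def sum.distrib sum_distrib_left[symmetric] feasible_weights_def)
  have z0: "0 \<le> z e" for e
  proof (cases "e \<in> N")
    case True
    then have "\<epsilon> * - d e \<le> y e" using \<epsilon>_le[OF True] by (simp add: N_def field_simps)
    then show ?thesis by (simp add: z_def)
  next
    case False
    then have "0 \<le> d e" using d(2)[of e] by (cases "e \<in> S") (auto simp: N_def)
    then show ?thesis using y0[of e] \<epsilon>0 by (simp add: z_def)
  qed
  show thesis
  proof (rule that[of z])
    show "feasible_weights T z"
      unfolding feasible_weights_def using z0 z_sum y d(2) S
      by (auto simp: z_def feasible_weights_def S_def)
    show "payment T (\<tau> i) z = payment T (\<tau> i) y" if "i \<in> {1..n}" for i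
    proof -
      have "payment T (\<tau> i) z = payment T (\<tau> i) y + \<epsilon> * payment T (\<tau> i) d"
        unfolding payment_def
        by (simp add: z_def distrib_left sum.distrib sum_distrib_left mult.left_commute)
      then show ?thesis using d_pay[OF that] by simp
    qed
    have "z p = 0" using p by (simp add: z_def N_def)
    then have "{e. z e \<noteq> 0} \<subseteq> S - {p}" using d(2) by (auto simp: z_def S_def)
    then have "card {e. z e \<noteq> 0} \<le> card (S - {p})" using finS by (intro card_mono) auto
    also have "\<dots> < card S" using finS p by (intro card_Diff1_less) (auto simp: N_def)
    finally show "card {e. z e \<noteq> 0} < card {e. y e \<noteq> 0}" by (simp add: S_def)
  qed
qed

text \<open>Among the optimal weights take those of least support; a larger support could be reduced
  with all payments, hence optimality, unchanged.\<close>

lemma optimal_weights_small_support: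
  fixes b :: "nat \<Rightarrow> real" and \<tau> :: "nat \<Rightarrow> 'm::finite \<Rightarrow> real"
  assumes "finite T" "T \<noteq> {}"
  obtains y where "feasible_weights T y" "card {e. y e \<noteq> 0} \<le> CARD('m) + n"
    "\<And>z. feasible_weights T z \<Longrightarrow>
      (\<Sum>i=1..n. min (b i) (payment T (\<tau> i) z)) \<le> (\<Sum>i=1..n. min (b i) (payment T (\<tau> i) y))"
proof -
  define opt where "opt y \<longleftrightarrow> feasible_weights T y \<and> (\<forall>z. feasible_weights T z \<longrightarrow>
      (\<Sum>i=1..n. min (b i) (payment T (\<tau> i) z)) \<le> (\<Sum>i=1..n. min (b i) (payment T (\<tau> i) y)))" for y
  obtain y0 where "opt y0"
    using optimal_weights_exist[OF assms, where I = "{1..n}" and b = b and \<tau> = \<tau>] unfolding opt_def by blast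
  from ex_has_least_nat[of opt, OF this, of "\<lambda>y. card {e. y e \<noteq> 0}"]
  obtain y where y: "opt y" "\<And>z. opt z \<Longrightarrow> card {e. y e \<noteq> 0} \<le> card {e. z e \<noteq> 0}" by blast
  have "card {e. y e \<noteq> 0} \<le> CARD('m) + n"
  proof (rule ccontr)
    assume "\<not> ?thesis"
    then have "CARD('m) + n < card {e. y e \<noteq> 0}" by simp
    moreover have "feasible_weights T y" using y(1) by (simp add: opt_def)
    ultimately obtain z where z: "feasible_weights T z"
      "\<And>i. i \<in> {1..n} \<Longrightarrow> payment T (\<tau> i) z = payment T (\<tau> i) y"
      "card {e. z e \<noteq> 0} < card {e. y e \<noteq> 0}"
      using reduce_support[OF assms(1), where \<tau> = \<tau>] by blast
    have "(\<Sum>i=1..n. min (b i) (payment T (\<tau> i) z)) = (\<Sum>i=1..n. min (b i) (payment T (\<tau> i) y))"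
      using z(2) by (intro sum.cong) auto
    then have "opt z" using y(1) z(1) unfolding opt_def by simp
    then show False using y(2)[of z] z(3) by simp
  qed
  then show thesis using that[of y] y(1) unfolding opt_def by blast
qed

section \<open>Bounding an arbitrary separable price\<close>

text \<open>Chains the bound by the greatest demands with the dominating weights; the cap by the
  budget is monotone in the payment.\<close>

lemma total_revenue_le_weights:
  fixes q :: "real ^ 'm \<Rightarrow> real" and \<tau> :: "nat \<Rightarrow> 'm \<Rightarrow> real"
  assumes T: "finite T" "T \<noteq> {}" "\<And>t. t \<in> T \<Longrightarrow> 0 \<le> t"
    and b: "\<And>i. i \<in> {1..n} \<Longrightarrow> 0 \<le> b i" and \<tau>: "\<And>i j. i \<in> {1..n} \<Longrightarrow> \<tau> i j \<in> T"
    and q: "separable_MLC_pricing q"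
  obtains y where "feasible_weights T y"
    "total_revenue n (\<lambda>i. linear_valuation (\<tau> i)) b q \<le> (\<Sum>i=1..n. min (b i) (payment T (\<tau> i) y))"
proof -
  obtain h where h: "\<And>x. x \<in> unit_cube \<Longrightarrow> q x = (\<Sum>j\<in>UNIV. h j (x $ j))"
    "\<And>j. h j 0 = 0" "\<And>j. mono_on {0..1} (h j)" "\<And>j. lower_semicont_unit (h j)"
    using separable_components[OF q] by blast
  \<comment> \<open>The choice depends only on the dataset and the slope, not on the buyer, so a
    single weight function for each dataset serves all buyers.\<close>
  define X where "X j t = (SOME x. greatest_demand (h j) t x)" for j t
  have X: "greatest_demand (h j) t (X j t)" if "t \<in> T" for j t
    unfolding X_def using greatest_demand_exists[OF h(3,4) T(3)[OF that]] by (rule someI_ex)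
  have "\<exists>w. (\<forall>t\<in>T. 0 \<le> w t) \<and> sum w T = 1
      \<and> (\<forall>t\<in>T. h j (X j t) \<le> (\<Sum>s\<in>{s \<in> T. s \<le> t}. s * w s))" for j
    using dominating_slope_weights[OF T h(2) X, of j] by metis
  then obtain w where w: "\<And>j t. t \<in> T \<Longrightarrow> 0 \<le> w j t" "\<And>j. sum (w j) T = 1"
    "\<And>j t. t \<in> T \<Longrightarrow> h j (X j t) \<le> (\<Sum>s\<in>{s \<in> T. s \<le> t}. s * w j s)" by metis
  define y where "y = (\<lambda>(j, t). if t \<in> T then w j t else 0)"
  have lsc: "lower_continuous q" "q 0 = 0"
    using q by (auto simp: separable_MLC_pricing_def MLC_def pricing_function_def)
  show thesis
  proof (rule that[of y])
    show "feasible_weights T y" using w by (auto simp: feasible_weights_def y_def)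
    show "total_revenue n (\<lambda>i. linear_valuation (\<tau> i)) b q
        \<le> (\<Sum>i=1..n. min (b i) (payment T (\<tau> i) y))"
      unfolding total_revenue_def
    proof (intro sum_mono)
      fix i assume i: "i \<in> {1..n}"
      have "revenue q (linear_valuation (\<tau> i)) (b i) \<le> min (b i) (\<Sum>j\<in>UNIV. h j (X j (\<tau> i j)))"
        by (rule revenue_le_separable[OF lsc b[OF i] h(1,3) X[OF \<tau>[OF i]]])
      also have "(\<Sum>j\<in>UNIV. h j (X j (\<tau> i j))) \<le> payment T (\<tau> i) y"
        unfolding payment_eq[OF T(1)]
        by (intro sum_mono order_trans[OF w(3)[OF \<tau>[OF i]]]) (auto simp: y_def intro!: sum_mono)
      then have "min (b i) (\<Sum>j\<in>UNIV. h j (X j (\<tau> i j))) \<le> min (b i) (payment T (\<tau> i) y)" by simp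
      finally show "revenue q (linear_valuation (\<tau> i)) (b i) \<le> min (b i) (payment T (\<tau> i) y)" .
    qed
  qed
qed

theorem mainTheorem4:
  fixes n :: nat
    and \<tau> :: "nat \<Rightarrow> 'm::finite \<Rightarrow> real"
    and b :: "nat \<Rightarrow> real"
  assumes "n \<ge> 1"
    and "\<And>i. i \<in> {1..n} \<Longrightarrow> b i \<ge> 0"
    and "\<And>i j. i \<in> {1..n} \<Longrightarrow> \<tau> i j \<ge> 0"
  shows "\<exists>(p :: real ^ 'm \<Rightarrow> real) (pc :: 'm \<Rightarrow> real \<Rightarrow> real).
           (\<forall>x\<in>unit_cube. p x = (\<Sum>j\<in>UNIV. pc j (x $ j))) \<and>
           (\<forall>j. mono_on {0..1} (pc j) \<and> continuous_on {0..1} (pc j) \<and>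
                convex_on {0..1} (pc j) \<and> piecewise_linear (pc j)) \<and>
           separable_MLC_pricing p \<and>
           (\<forall>q :: real ^ 'm \<Rightarrow> real. separable_MLC_pricing q \<longrightarrow>
                total_revenue n (\<lambda>i. linear_valuation (\<tau> i)) b q
                  \<le> total_revenue n (\<lambda>i. linear_valuation (\<tau> i)) b p) \<and>
           (\<forall>j. finite (kinks (pc j))) \<and>
           (\<Sum>j\<in>UNIV. card (kinks (pc j))) \<le> n"
proof -
  \<comment> \<open>All slopes of all buyers; nonempty because \<open>n \<ge> 1\<close>.\<close>
  define T where "T = (\<Union>i\<in>{1..n}. range (\<tau> i))"
  have T: "finite T" "T \<noteq> {}" "\<And>t. t \<in> T \<Longrightarrow> 0 \<le> t"
    using assms by (auto simp: T_def)
  have \<tau>: "\<tau> i j \<in> T" if "i \<in> {1..n}" for i j using that unfolding T_def by blast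
  obtain y where y: "feasible_weights T y" "card {e. y e \<noteq> 0} \<le> CARD('m) + n"
    and opt: "\<And>z. feasible_weights T z \<Longrightarrow>
      (\<Sum>i=1..n. min (b i) (payment T (\<tau> i) z)) \<le> (\<Sum>i=1..n. min (b i) (payment T (\<tau> i) y))"
    using optimal_weights_small_support[OF T(1,2), of n b \<tau>] by blast
  interpret sw: slope_weights T "\<lambda>t. y (j, t)" for j
    by (rule feasible_weights_slope_weights[OF T y(1)])
  define p where "p x = (\<Sum>j\<in>UNIV. sw.price j (x $ j))" for x :: "real ^ 'm"
  have p_cont: "continuous_on A p" for A
    unfolding p_def
    by (intro continuous_intros continuous_on_compose2[OF sw.price_continuous]) auto
  have p_mono: "mono p"
    unfolding p_def by (intro monoI sum_mono monoD[OF sw.price_mono]) (simp add: less_eq_vec_def)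
  have p_0: "p 0 = 0" by (simp add: p_def sw.price_0)
  have p_conv: "convex_on unit_cube p"
  proof (intro convex_onI convex_unit_cube)
    fix u :: real and x z :: "real ^ 'm" assume u: "0 < u" "u < 1"
    have "p ((1 - u) *\<^sub>R x + u *\<^sub>R z)
        \<le> (\<Sum>j\<in>UNIV. (1 - u) * sw.price j (x $ j) + u * sw.price j (z $ j))"
      unfolding p_def using u convex_onD[OF sw.price_convex, of u] by (intro sum_mono) simp
    then show "p ((1 - u) *\<^sub>R x + u *\<^sub>R z) \<le> (1 - u) * p x + u * p z"
      by (simp add: p_def sum.distrib sum_distrib_left)
  qed
  have p_nonneg: "0 \<le> p x" if "x \<in> unit_cube" for x
    using monoD[OF p_mono, of 0 x] that p_0 by (simp add: less_eq_vec_def unit_cube_def)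
  have p_sep: "separable_MLC_pricing p"
    unfolding separable_MLC_pricing_def pricing_function_def MLC_def
    using p_mono p_nonneg p_0 continuous_on_imp_lower_continuous[OF p_cont]
    by (auto simp: separable_def p_def intro: mono_on_subset)
  have "(\<Sum>i=1..n. min (b i) (payment T (\<tau> i) y))
      \<le> total_revenue n (\<lambda>i. linear_valuation (\<tau> i)) b p"
    unfolding total_revenue_def
  proof (intro sum_mono)
    fix i assume i: "i \<in> {1..n}"
    \<comment> \<open>The unconstrained optimum of buyer \<open>i\<close>, taken coordinatewise; its
      price is the payment in the weights.\<close>
    define z :: "real ^ 'm" where "z = (\<chi> j. sw.cdf j (\<tau> i j))"
    have "p z = payment T (\<tau> i) y"
      unfolding payment_eq[OF T(1)] p_def z_def
      by (intro sum.cong) (auto simp: sw.price_at_cdf[OF \<tau>[OF i]])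
    moreover have "min (b i) (p z) \<le> revenue p (linear_valuation (\<tau> i)) (b i)"
    proof (rule revenue_ge_convex[OF p_cont p_conv p_0 assms(2)[OF i]])
      show "z \<in> unit_cube" by (simp add: z_def unit_cube_def sw.cdf_bounds)
      show "linear_valuation (\<tau> i) x - p x \<le> linear_valuation (\<tau> i) z - p z" for x
        unfolding linear_valuation_def p_def z_def sum_subtractf[symmetric]
        by (intro sum_mono) (simp add: sw.cdf_maximizes_utility[OF \<tau>[OF i]])
    qed
    ultimately show "min (b i) (payment T (\<tau> i) y) \<le> revenue p (linear_valuation (\<tau> i)) (b i)"
      by simp
  qed
  note p_ge = this
  have p_opt: "total_revenue n (\<lambda>i. linear_valuation (\<tau> i)) b q
      \<le> total_revenue n (\<lambda>i. linear_valuation (\<tau> i)) b p" if "separable_MLC_pricing q" for q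
  proof (rule total_revenue_le_weights[OF T _ _ that, of n b \<tau>])
    fix z assume "feasible_weights T z"
      and q: "total_revenue n (\<lambda>i. linear_valuation (\<tau> i)) b q
        \<le> (\<Sum>i=1..n. min (b i) (payment T (\<tau> i) z))"
    note q also note opt[OF \<open>feasible_weights T z\<close>] also note p_ge
    finally show ?thesis .
  qed (use assms(2) \<tau> in auto)
  \<comment> \<open>The support splits over the datasets, so its size is the sum of the numbers of
    nonzero weights.\<close>
  have "{e. y e \<noteq> 0} = (SIGMA j:UNIV. {t \<in> T. y (j, t) \<noteq> 0})"
    using y(1) by (auto simp: feasible_weights_def)
  then have "(\<Sum>j\<in>UNIV. card {t \<in> T. y (j, t) \<noteq> 0}) \<le> CARD('m) + n"
    using y(2) T(1) by simp
  \<comment> \<open>Each dataset has at least one kink fewer than nonzero weights; summed over the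
    datasets this saves exactly the term \<open>CARD('m)\<close>.\<close>
  moreover have "(\<Sum>j\<in>UNIV. card (kinks (sw.price j)) + 1) \<le> (\<Sum>j\<in>UNIV. card {t \<in> T. y (j, t) \<noteq> 0})"
    using sw.card_kinks_price(2) by (intro sum_mono) (simp add: Suc_le_eq)
  ultimately have few_kinks: "(\<Sum>j\<in>UNIV. card (kinks (sw.price j))) \<le> n"
    unfolding sum.distrib by simp
  have price_props: "mono_on {0..1} (sw.price j) \<and> continuous_on {0..1} (sw.price j) \<and>
      convex_on {0..1} (sw.price j) \<and> piecewise_linear (sw.price j)" for j
    by (intro conjI mono_on_subset[OF sw.price_mono] continuous_on_subset[OF sw.price_continuous]
        convex_on_subset[OF sw.price_convex] sw.price_piecewise_linear) simp_all
  show ?thesis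
  proof (rule exI[of _ p], rule exI[of _ sw.price], intro conjI)
    show "\<forall>x\<in>unit_cube. p x = (\<Sum>j\<in>UNIV. sw.price j (x $ j))" by (simp add: p_def)
  qed (intro allI impI price_props p_sep p_opt sw.card_kinks_price(1) few_kinks; assumption)+
qed

end
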